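(* Let $\mathcal{G}$ be a bipartite graph with weight matrix $W\in\overline{\mathbb{R}}^{n\times m}$ and let $e^*\in\mathbf{E}(W)$ be a bottleneck edge. Let $\widehat{\mathcal{S}}_{e^*}$ be the set of edges returned by the Exclusive Set Algorithm on input $(W,e^* )$, and let $\widehat{\Pi}$ be the lexicographic assignment for $W$. Then: (i) $\widehat{\mathcal{S}}_{e^*}$ is an exclusive set relative to $e^*$. (ii) If the Uniqueness Assumption holds, then $$\forall\,\Pi\in\mathcal{P}_{e^*},\ \forall\,\mathcal{S}_{e^*}\in\mathbf{S}_{e^*}:\quad \operatorname{lexmax}\left(\mathcal{L}_0\cap\mathcal{X}_{\widehat{\mathcal{S}}_{e^*}}\cap\mathcal{A}_{\widehat{\Pi}}\right)\succeq\operatorname{lexmax}\left(\mathcal{L}_0\cap\mathcal{X}_{\mathcal{S}_{e^*}}\cap\mathcal{A}_{\Pi}\right).$$ Therefore, the array of intervals $\Lambda=\operatorname{lexmax}(\mathcal{L}_0\cap\mathcal{X}_{\widehat{\mathcal{S}}_{e^*}}\cap\mathcal{A}_{\widehat{\Pi}})$, given by the Interval Formula with $\mathcal{S}_{e^*}=\widehat{\mathcal{S}}_{e^*}$ and $\Pi=\widehat{\Pi}$, is the lexicographically largest array of intervals $([-\underline{\lambda}_e,\overline{\lambda}_e])_{e\in\mathcal{E}}$ such that $\underline{\lambda}_e,\overline{\lambda}_e\ge 0$ for all $e\in\mathcal{E}$ and every perturbation $P\in\Lambda$ satisfies $e^*\in\mathbf{E}(W+P)$; equivalently, $\Lambda=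\operatorname{lexmax}(\mathcal{L}_0\cap\mathcal{L}_E)$.
   Context: Graph and assignments. $\mathcal{G}=(\mathcal{V}_1\cup\mathcal{V}_2,\mathcal{E})$ is a bipartite graph with disjoint vertex sets, $\mathcal{E}\subseteq\mathcal{V}_1\times\mathcal{V}_2$, $n=|\mathcal{V}_1|\ge m=|\mathcal{V}_2|\ge 1$. $\overline{\mathbb{R}}=\mathbb{R}\cup\{-\infty,+\infty\}$. The weight matrix $W\in\overline{\mathbb{R}}^{n\times m}$ has entry $w_e$ for each edge $e\in\mathcal{E}$, and entry $+\infty$ for each pair not in $\mathcal{E}$. An assignment is a set $\Pi\subseteq\mathcal{E}$ such that every vertex of $\mathcal{V}_2$ lies in exactly one edge of $\Pi$ and every vertex of $\mathcal{V}_1$ lies in at most one edge of $\Pi$. $\mathcal{P}^{n\times m}$ is the set of all assignments, and $\mathcal{P}_e=\{\Pi\in\mathcal{P}^{n\times m}: e\in\Pi\}$. Bottleneck notions. For any weights $W$, $\mathbf{BAP}(W)$ is the set of bottleneck assignments, i.e. assignments $\Pi$ minimising $\max_{e\in\Pi}w_e$ over $\mathcal{P}^{n\times m}$. $\mathbf{E}(W)$ is the set of bottleneck edges, i.e. the maximum weight edges in all bottleneck assignments: edges $e$ for which there is $\Pi\in\mathbf{BAP}(W)$ with $e\in\Pi$ and $w_e=\max_{e'\in\Pi}w_{e'}$. Arrays of intervals. An array of intervals $\Lambda\subseteq\overline{\mathbb{R}}^{n\times m}$ is an $n\times m$ array of intervals over the extended reals, written $\Lambda=([-\underline{\lambda}_e,\overline{\lambda}_e])_{e\in\mathcal{E}}$,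 where $[-\underline{\lambda}_e,\overline{\lambda}_e]$ is the interval of edge $e$. A perturbation $P\in\overline{\mathbb{R}}^{n\times m}$, with element $P[e]$ corresponding to edge $e$, satisfies $P\in\Lambda$ if $P[e]\in[-\underline{\lambda}_e,\overline{\lambda}_e]$ for all $e\in\mathcal{E}$. $\mathcal{L}_0$ is the set of arrays containing the zero perturbation (equivalently, all $\underline{\lambda}_e,\overline{\lambda}_e\ge0$). $\mathcal{L}_E$ is the set of arrays $\Lambda$ such that $e^*\in\mathbf{E}(W+P)$ for all $P\in\Lambda$. Lexicographic order. $\rho_k(\Lambda)$ is the $k$-th minimum magnitude upper or lower bound of any of the intervals in $\Lambda$. $\Lambda_a\succ\Lambda_b$ if there is $i\in\{1,\dots,nm\}$ with $\rho_i(\Lambda_a)>\rho_i(\Lambda_b)$ and $\rho_k(\Lambda_a)=\rho_k(\Lambda_b)$ for all $k<i$; $\succeq$ denotes the corresponding non-strict lexicographic ordering. $\operatorname{lexmax}(\mathcal{I})$ denotes a lexicographic maximal element of the set $\mathcal{I}$ of arrays, i.e. $\Lambda^*\in\mathcal{I}$ with $\Lambda^*\succeq\Lambda$ for all $\Lambda\in\mathcal{I}$. Exclusive sets. $\mathcal{S}_{e^*}\subset\mathcal{E}$ is an exclusive set relative to $e^*$ if $e^*\notin\mathcal{S}_{e^*}$ and $\mathcal{P}^{n\times m}=\mathcal{P}_{e^*}\cup\bigcup_{e\in\mathcal{S}_{e^*}}\mathcal{P}_e$. $\mathbf{S}_{e^*}$ is the set of all exclusive sets relative to $e^*$. Constraint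 sets. $\mathcal{A}_\Pi=\{\Lambda: \forall e\in\Pi\setminus\{e^*\},\ w_{e^*}-\underline{\lambda}_{e^*}\ge w_e+\overline{\lambda}_e\}$, $\mathcal{X}_{\mathcal{S}_{e^*}}=\{\Lambda: \forall e\in\mathcal{S}_{e^*},\ w_{e^*}+\overline{\lambda}_{e^*}\le w_e-\underline{\lambda}_e\}$. Lexicographic assignment. For an assignment $\Pi$, $\phi_i(\Pi,W)$ is the $i$-th largest element of $\{w_e: e\in\Pi\}$, i.e. the $i$-th largest weight. $\Pi$ is a lexicographic assignment if there does not exist an assignment $\Pi'$ such that, for some $i$, $\phi_i(\Pi',W)<\phi_i(\Pi,W)$ and $\phi_j(\Pi',W)=\phi_j(\Pi,W)$ for all $j<i$. Exclusive Set Algorithm (input $W,e^*$). Start with $\widehat{\mathcal{S}}_{e^*}=\varnothing$. Set $w_{e^*}\leftarrow\infty$. Let $e\leftarrow\mathbf{E}(W)$ be a bottleneck edge for the current weights. While $w_e\ne\infty$: add $e$ to $\widehat{\mathcal{S}}_{e^*}$, set $w_e\leftarrow\infty$ (removing $e$ from the graph), and let $e\leftarrow\mathbf{E}(W)$ be a bottleneck edge for the new weights. Return $\widehat{\mathcal{S}}_{e^*}$. (Weights are modified only inside the algorithm; everywhere else $w_e$ is the original weight.) Uniqueness Assumption. For the graph $\mathcal{G}$ with weights $W$, the bottleneck edge $e\in\mathbf{E}(W)$ at each iteration of the Exclusive Set Algorithm is unique. Interval Formula. For $\mathcal{S}_{e^*}$ and $\Pi$, put $\overline{\lambda}_{e^*}=\min_{e\in\mathcal{S}_{e^*}}\frac{w_e-w_{e^*}}{2}$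 and $\underline{\lambda}_{e^*}=\min_{e\in\Pi\setminus\{e^*\}}\frac{w_{e^*}-w_e}{2}$. For each $e\in\mathcal{E}$, the interval $[-\underline{\lambda}_e,\overline{\lambda}_e]$ is - $[w_{e^*}+\overline{\lambda}_{e^*}-w_e,\ \infty]$ if $e\in\mathcal{S}_{e^*}$; - $[-\infty,\ w_{e^*}-\underline{\lambda}_{e^*}-w_e]$ if $e\in\Pi\setminus\{e^*\}$; - $[-\underline{\lambda}_{e^*},\overline{\lambda}_{e^*}]$ if $e=e^*$; - $[-\infty,\infty]$ if $e\notin\mathcal{S}_{e^*}\cup\Pi$.
   Formalization: Edges are assumed to have weight other than +∞ (else (i) fails); in (ii) no edge has weight -∞ (else W+P and the Interval Formula are undefined), and the Uniqueness Assumption includes that E(W) for the original weights is the single edge e* (else (ii) fails). *)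

theory Defs
  imports Complex_Main "HOL-Library.Extended_Real" "HOL-Library.Multiset"
begin

type_synonym 'v edge = "'v \<times> 'v"

section \<open>Bipartite graphs, weights and assignments\<close>

definition bipartite_graph :: "'v set \<Rightarrow> 'v set \<Rightarrow> 'v edge set \<Rightarrow> bool" where
  "bipartite_graph V1 V2 E \<longleftrightarrow>
     finite V1 \<and> finite V2 \<and> V1 \<inter> V2 = {} \<and> E \<subseteq> V1 \<times> V2 \<and>
     card V2 \<le> card V1 \<and> 1 \<le> card V2"

text \<open>The weight \<open>\<infinity>\<close> is the marker for a pair that is not an edge (deleting an edge means
  setting its weight to \<open>\<infinity>\<close>); accordingly edges have weight different from \<open>\<infinity>\<close>.\<close>

definition weight_matrix :: "'v set \<Rightarrow> 'v set \<Rightarrow> 'v edge set \<Rightarrow> ('v edge \<Rightarrow> ereal) \<Rightarrow> bool" where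
  "weight_matrix V1 V2 E w \<longleftrightarrow>
     (\<forall>e\<in>E. w e \<noteq> \<infinity>) \<and> (\<forall>e\<in>V1 \<times> V2 - E. w e = \<infinity>)"

definition assignments :: "'v set \<Rightarrow> 'v set \<Rightarrow> 'v edge set \<Rightarrow> 'v edge set set" where
  "assignments V1 V2 E = {\<Pi>. \<Pi> \<subseteq> E \<and>
     (\<forall>v\<in>V2. \<exists>!e. e \<in> \<Pi> \<and> snd e = v) \<and>
     (\<forall>u\<in>V1. \<exists>\<^sub>\<le>\<^sub>1e. e \<in> \<Pi> \<and> fst e = u)}"

definition assignments_with ::
  "'v set \<Rightarrow> 'v set \<Rightarrow> 'v edge set \<Rightarrow> 'v edge \<Rightarrow> 'v edge set set" where
  "assignments_with V1 V2 E e = {\<Pi> \<in> assignments V1 V2 E. e \<in> \<Pi>}"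

text \<open>Below, the graph (and hence its set of assignments) stays fixed while the weights vary;
  the weights of edges may become \<open>\<infinity>\<close> or \<open>-\<infinity>\<close>. Assignments are nonempty and finite,
  so that the maximum is meaningful.\<close>

definition max_weight :: "('v edge \<Rightarrow> ereal) \<Rightarrow> 'v edge set \<Rightarrow> ereal" where
  "max_weight w \<Pi> = Max (w ` \<Pi>)"

definition bottleneck_assignments ::
  "'v set \<Rightarrow> 'v set \<Rightarrow> 'v edge set \<Rightarrow> ('v edge \<Rightarrow> ereal) \<Rightarrow> 'v edge set set" where
  "bottleneck_assignments V1 V2 E w = {\<Pi> \<in> assignments V1 V2 E.
     \<forall>\<Pi>'\<in>assignments V1 V2 E. max_weight w \<Pi> \<le> max_weight w \<Pi>'}"

definition bottleneck_edges ::
  "'v set \<Rightarrow> 'v set \<Rightarrow> 'v edge set \<Rightarrow> ('v edge \<Rightarrow> ereal) \<Rightarrow> 'v edge set" where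
  "bottleneck_edges V1 V2 E w = {e.
     \<exists>\<Pi>\<in>bottleneck_assignments V1 V2 E w. e \<in> \<Pi> \<and> w e = max_weight w \<Pi>}"

text \<open>The \<open>i\<close>-th largest weight in an assignment, \<open>1 \<le> i \<le> card V2\<close>, counted with multiplicity.\<close>

definition weight_rank :: "('v edge \<Rightarrow> ereal) \<Rightarrow> 'v edge set \<Rightarrow> nat \<Rightarrow> ereal" where
  "weight_rank w \<Pi> i = rev (sorted_list_of_multiset (image_mset w (mset_set \<Pi>))) ! (i - 1)"

definition lexicographic_assignment ::
  "'v set \<Rightarrow> 'v set \<Rightarrow> 'v edge set \<Rightarrow> ('v edge \<Rightarrow> ereal) \<Rightarrow> 'v edge set \<Rightarrow> bool" where
  "lexicographic_assignment V1 V2 E w \<Pi> \<longleftrightarrow>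
     \<Pi> \<in> assignments V1 V2 E \<and>
     \<not> (\<exists>\<Pi>'\<in>assignments V1 V2 E. \<exists>i\<in>{1..card V2}.
          weight_rank w \<Pi>' i < weight_rank w \<Pi> i \<and>
          (\<forall>j\<in>{1..<i}. weight_rank w \<Pi>' j = weight_rank w \<Pi> j))"

section \<open>Exclusive sets and the Exclusive Set Algorithm\<close>

definition exclusive_sets ::
  "'v set \<Rightarrow> 'v set \<Rightarrow> 'v edge set \<Rightarrow> 'v edge \<Rightarrow> 'v edge set set" where
  "exclusive_sets V1 V2 E es = {S. S \<subset> E \<and> es \<notin> S \<and>
     assignments V1 V2 E =
       assignments_with V1 V2 E es \<union> (\<Union>e\<in>S. assignments_with V1 V2 E e)}"

text \<open>States \<open>(S, w')\<close> reachable at the head of the loop: \<open>S\<close> is the set collected so far and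
  \<open>w'\<close> the current weights. The choice of a bottleneck edge is nondeterministic.\<close>

inductive esa_reach ::
  "'v set \<Rightarrow> 'v set \<Rightarrow> 'v edge set \<Rightarrow> ('v edge \<Rightarrow> ereal) \<Rightarrow> 'v edge
     \<Rightarrow> 'v edge set \<Rightarrow> ('v edge \<Rightarrow> ereal) \<Rightarrow> bool"
  for V1 V2 E w es where
  init: "esa_reach V1 V2 E w es {} (w(es := \<infinity>))"
| step: "esa_reach V1 V2 E w es (insert e S) (w'(e := \<infinity>))"
    if "esa_reach V1 V2 E w es S w'" "e \<in> bottleneck_edges V1 V2 E w'" "w' e \<noteq> \<infinity>"

definition esa_returns ::
  "'v set \<Rightarrow> 'v set \<Rightarrow> 'v edge set \<Rightarrow> ('v edge \<Rightarrow> ereal) \<Rightarrow> 'v edge \<Rightarrow> 'v edge set \<Rightarrow> bool" where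
  "esa_returns V1 V2 E w es S \<longleftrightarrow>
     (\<exists>w' e. esa_reach V1 V2 E w es S w' \<and> e \<in> bottleneck_edges V1 V2 E w' \<and> w' e = \<infinity>)"

text \<open>Uniqueness concerns the bottleneck edge of the input weights \<open>w\<close> and the bottleneck edge at
  every iteration, i.e. whenever the loop body is entered. It is not required on loop exit, where
  all bottleneck edges have weight \<open>\<infinity>\<close>. Uniqueness for \<open>w\<close> itself cannot be omitted: for the
  complete graph on two plus two vertices with perfect matchings \<open>{e*, g}\<close> (weights 5, 3) and
  \<open>{f, h}\<close> (weights 5, 2), every iteration has a unique bottleneck edge, but the lexicographic
  assignment \<open>{f, h}\<close> avoids \<open>e*\<close>.\<close>

definition uniqueness_assumption ::
  "'v set \<Rightarrow> 'v set \<Rightarrow> 'v edge set \<Rightarrow> ('v edge \<Rightarrow> ereal) \<Rightarrow> 'v edge \<Rightarrow> bool" where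
  "uniqueness_assumption V1 V2 E w es \<longleftrightarrow>
     (\<exists>!e. e \<in> bottleneck_edges V1 V2 E w) \<and>
     (\<forall>S w'. esa_reach V1 V2 E w es S w' \<and> (\<exists>e\<in>bottleneck_edges V1 V2 E w'. w' e \<noteq> \<infinity>)
        \<longrightarrow> (\<exists>!e. e \<in> bottleneck_edges V1 V2 E w'))"

section \<open>Arrays of intervals\<close>

text \<open>An array \<open>\<Lambda>\<close> assigns to each edge \<open>e\<close> a pair \<open>(a, b)\<close> representing the interval
  \<open>[-a, b]\<close>; note the sign of the first component. Only the entries at edges matter.\<close>

type_synonym 'v interval_array = "'v edge \<Rightarrow> ereal \<times> ereal"

abbreviation lam_lo :: "'v interval_array \<Rightarrow> 'v edge \<Rightarrow> ereal" where
  "lam_lo \<Lambda> e \<equiv> fst (\<Lambda> e)"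

abbreviation lam_up :: "'v interval_array \<Rightarrow> 'v edge \<Rightarrow> ereal" where
  "lam_up \<Lambda> e \<equiv> snd (\<Lambda> e)"

definition perturbations :: "'v edge set \<Rightarrow> 'v interval_array \<Rightarrow> ('v edge \<Rightarrow> ereal) set" where
  "perturbations E \<Lambda> = {P. \<forall>e\<in>E. P e \<in> {- lam_lo \<Lambda> e .. lam_up \<Lambda> e}}"

definition L_zero :: "'v edge set \<Rightarrow> 'v interval_array set" where
  "L_zero E = {\<Lambda>. (\<lambda>_. 0) \<in> perturbations E \<Lambda>}"

definition L_E ::
  "'v set \<Rightarrow> 'v set \<Rightarrow> 'v edge set \<Rightarrow> ('v edge \<Rightarrow> ereal) \<Rightarrow> 'v edge \<Rightarrow> 'v interval_array set" where
  "L_E V1 V2 E w es = {\<Lambda>. \<forall>P\<in>perturbations E \<Lambda>. es \<in> bottleneck_edges V1 V2 E (\<lambda>e. w e + P e)}"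

definition A_set ::
  "('v edge \<Rightarrow> ereal) \<Rightarrow> 'v edge \<Rightarrow> 'v edge set \<Rightarrow> 'v interval_array set" where
  "A_set w es \<Pi> = {\<Lambda>. \<forall>e\<in>\<Pi> - {es}. w es - lam_lo \<Lambda> es \<ge> w e + lam_up \<Lambda> e}"

definition X_set ::
  "('v edge \<Rightarrow> ereal) \<Rightarrow> 'v edge \<Rightarrow> 'v edge set \<Rightarrow> 'v interval_array set" where
  "X_set w es S = {\<Lambda>. \<forall>e\<in>S. w es + lam_up \<Lambda> es \<le> w e - lam_lo \<Lambda> e}"

text \<open>The \<open>k\<close>-th smallest magnitude (\<open>k \<ge> 1\<close>, with multiplicity) among the \<open>2 * card E\<close> upper and
  lower bounds. The order below compares the ranks \<open>1, \<dots>, n * m\<close>; ranks that exceed the number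
  of bounds get the same value for all arrays and so do not influence the order.\<close>

definition bound_magnitudes :: "'v edge set \<Rightarrow> 'v interval_array \<Rightarrow> ereal multiset" where
  "bound_magnitudes E \<Lambda> =
     image_mset (\<lambda>e. \<bar>- lam_lo \<Lambda> e\<bar>) (mset_set E) + image_mset (\<lambda>e. \<bar>lam_up \<Lambda> e\<bar>) (mset_set E)"

definition rho :: "'v edge set \<Rightarrow> 'v interval_array \<Rightarrow> nat \<Rightarrow> ereal" where
  "rho E \<Lambda> k = (let xs = sorted_list_of_multiset (bound_magnitudes E \<Lambda>)
                 in if k \<le> length xs then xs ! (k - 1) else \<infinity>)"

definition lex_greater ::
  "'v set \<Rightarrow> 'v set \<Rightarrow> 'v edge set \<Rightarrow> 'v interval_array \<Rightarrow> 'v interval_array \<Rightarrow> bool" where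
  "lex_greater V1 V2 E \<Lambda>a \<Lambda>b \<longleftrightarrow>
     (\<exists>i\<in>{1..card V1 * card V2}. rho E \<Lambda>a i > rho E \<Lambda>b i \<and>
        (\<forall>k\<in>{1..<i}. rho E \<Lambda>a k = rho E \<Lambda>b k))"

definition lex_greater_eq ::
  "'v set \<Rightarrow> 'v set \<Rightarrow> 'v edge set \<Rightarrow> 'v interval_array \<Rightarrow> 'v interval_array \<Rightarrow> bool" where
  "lex_greater_eq V1 V2 E \<Lambda>a \<Lambda>b \<longleftrightarrow>
     lex_greater V1 V2 E \<Lambda>a \<Lambda>b \<or>
     (\<forall>k\<in>{1..card V1 * card V2}. rho E \<Lambda>a k = rho E \<Lambda>b k)"

text \<open>The order is only a total preorder on arrays, so a lexicographic maximum need not be unique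
  (nor exist, e.g. for the empty set); it is therefore a predicate.\<close>

definition is_lexmax ::
  "'v set \<Rightarrow> 'v set \<Rightarrow> 'v edge set \<Rightarrow> 'v interval_array set \<Rightarrow> 'v interval_array \<Rightarrow> bool" where
  "is_lexmax V1 V2 E I \<Lambda> \<longleftrightarrow> \<Lambda> \<in> I \<and> (\<forall>\<Lambda>'\<in>I. lex_greater_eq V1 V2 E \<Lambda> \<Lambda>')"

text \<open>The minimum over the empty set is \<open>\<infinity>\<close>. Components are negated lower endpoints, e.g. the
  interval \<open>[w es + u - w e, \<infinity>]\<close> becomes \<open>(- (w es + u - w e), \<infinity>)\<close>.\<close>

definition interval_formula ::
  "('v edge \<Rightarrow> ereal) \<Rightarrow> 'v edge \<Rightarrow> 'v edge set \<Rightarrow> 'v edge set \<Rightarrow> 'v interval_array" where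
  "interval_formula w es S \<Pi> e =
     (let u = (INF e\<in>S. (w e - w es) / 2);
          l = (INF e\<in>\<Pi> - {es}. (w es - w e) / 2)
      in if e \<in> S then (- (w es + u - w e), \<infinity>)
         else if e \<in> \<Pi> - {es} then (\<infinity>, w es - l - w e)
         else if e = es then (l, u)
         else (\<infinity>, \<infinity>))"

end

theory Submission
  imports Defs "HOL-Library.Multiset_Order"
begin

text \<open>The arrays in \<open>L_zero E \<inter> L_E\<close> are exactly those in \<open>L_zero E \<inter> X_set w es S \<inter> A_set w es \<Pi>\<close> for
  some exclusive set \<open>S\<close> and some assignment \<open>\<Pi>\<close> containing \<open>es\<close>, so it suffices to show that the
  array of the interval formula is maximal among all of these. Comparing sorted lists of equal length
  lexicographically is the same as comparing them in the multiset extension of the linear order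
  (of the dual order for lists sorted increasingly), and the latter is compatible with unions.
  Hence the bounds constrained by \<open>S\<close> and those constrained by \<open>\<Pi>\<close> can be treated separately. In both
  cases the optimum is determined by the multiset of weights of \<open>S\<close> or \<open>\<Pi>\<close>: a greedy exchange argument
  shows that the set returned by the algorithm has the largest weights among exclusive sets, and the
  lexicographic assignment has the smallest weights by definition.\<close>

section \<open>Lexicographic comparison via the multiset order\<close>

text \<open>Links the multiset order to lexicographic comparison. If the first differing entry were
  the smaller one in \<open>ys\<close>, the common prefix would cancel and \<open>xs ! i\<close>
  would exceed everything left in \<open>ys\<close>, giving \<open>N < M\<close>.\<close>

lemma less_multiset_imp_first_difference:
  fixes M N :: "'a::linorder multiset"
  assumes "M < N" and "size M = size N"
  defines "xs \<equiv> rev (sorted_list_of_multiset M)" and "ys \<equiv> rev (sorted_list_of_multiset N)"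
  obtains i where "i < size M" "xs ! i < ys ! i" "\<forall>j<i. xs ! j = ys ! j"
proof -
  have mset: "mset xs = M" "mset ys = N" by (auto simp: xs_def ys_def)
  then have len: "length xs = size M" "length ys = size M"
    using assms(2) by (metis size_mset)+
  have "xs \<noteq> ys" using assms(1) mset by auto
  then have ex: "\<exists>i. i < size M \<and> xs ! i \<noteq> ys ! i"
    using len by (metis nth_equalityI)
  define i where "i = (LEAST i. i < size M \<and> xs ! i \<noteq> ys ! i)"
  have i: "i < size M" "xs ! i \<noteq> ys ! i"
    using LeastI_ex[OF ex] unfolding i_def by auto
  have eq: "\<forall>j<i. xs ! j = ys ! j"
    using not_less_Least i(1) unfolding i_def by (metis (mono_tags, lifting) less_trans)
  have "\<not> ys ! i < xs ! i"
  proof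
    assume less: "ys ! i < xs ! i"
    have "take i xs = take i ys"
      using eq i(1) len by (intro nth_equalityI) auto
    moreover have "mset (drop i ys) < mset (drop i xs)"
    proof (rule ex_gt_imp_less_multiset, intro exI conjI allI impI)
      show "xs ! i \<in># mset (drop i xs)"
        using i(1) len by (metis Cons_nth_drop_Suc in_multiset_in_set list.set_intros(1))
      fix y assume "y \<in># mset (drop i ys)"
      then obtain j where j: "j < length (drop i ys)" "y = drop i ys ! j"
        by (auto simp: in_set_conv_nth)
      have "sorted_wrt (\<ge>) ys"
        unfolding ys_def by (simp add: sorted_wrt_rev)
      then have "y \<le> ys ! i"
        using j len by (cases "j = 0") (auto simp: sorted_wrt_iff_nth_less)
      then show "y < xs ! i" using less by simp
    qed
    ultimately have "mset (take i ys) + mset (drop i ys) < mset (take i xs) + mset (drop i xs)"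
      by simp
    then have "N < M" using mset by (metis append_take_drop_id mset_append)
    then show False using assms(1) by simp
  qed
  then show thesis using that i eq by auto
qed

lemma image_mset_mset_set_mono:
  fixes f g :: "'a \<Rightarrow> 'b::linorder"
  assumes "\<And>x. x \<in> A \<Longrightarrow> f x \<le> g x"
  shows "image_mset f (mset_set A) \<le> image_mset g (mset_set A)"
proof (cases "finite A")
  case True
  then show ?thesis using assms
    by (induction A) (auto intro: add_mset_le_le_le)
qed simp

text \<open>In the multiset order a single dominating element decides, whatever the sizes.
  \<open>A\<close> may be infinite, as \<open>mset_set A\<close> is then empty.\<close>

lemma image_mset_mset_set_dominated:
  fixes f g :: "'a \<Rightarrow> 'b::linorder"
  assumes "finite B" "b \<in> B" "\<And>x. x \<in> A \<Longrightarrow> f x < g b"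
  shows "image_mset f (mset_set A) < image_mset g (mset_set B)"
  by (rule ex_gt_imp_less_multiset, rule exI[of _ "g b"])
     (use assms in \<open>auto, metis elem_mset_set empty_iff equals0D mset_set.infinite set_mset_empty\<close>)

text \<open>The common part \<open>T\<close> cancels and \<open>b\<close> dominates what remains of
  \<open>A\<close>. The greedy argument compares two exclusive sets in this form.\<close>

lemma image_mset_mset_set_exchange:
  fixes f :: "'a \<Rightarrow> 'b::linorder"
  assumes "finite A" "finite B" "T \<subseteq> A" "T \<subseteq> B" "b \<in> B - T" "\<And>x. x \<in> A - T \<Longrightarrow> f x < f b"
  shows "image_mset f (mset_set A) \<le> image_mset f (mset_set B)"
proof -
  have split: "mset_set C = mset_set T + mset_set (C - T)" if "finite C" "T \<subseteq> C" for C
    using that by (metis mset_set_Union Diff_disjoint Diff_partition finite_Diff finite_subset)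
  have "image_mset f (mset_set (A - T)) < image_mset f (mset_set (B - T))"
    by (rule image_mset_mset_set_dominated[where b = b]) (use assms in auto)
  then show ?thesis
    by (simp add: split[OF assms(1,3)] split[OF assms(2,4)])
qed

section \<open>Sharing slacks between one edge and many others\<close>

text \<open>Unconstrained bounds are \<open>\<infinity>\<close>, hence \<open>bot\<close> after
  negation, and two constraint sets may leave different numbers of them. A surplus at
  \<open>bot\<close> is outweighed by a larger element in which \<open>N\<close> exceeds
  \<open>M\<close>; if \<open>M = N\<close>, the size condition forces \<open>a = b\<close>.\<close>

lemma le_multiset_pad_bot:
  fixes M N :: "'a::{linorder, order_bot} multiset"
  assumes "M \<le> N" "bot \<notin># N" "size M + a = size N + b"
  shows "M + replicate_mset a bot \<le> N + replicate_mset b bot"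
proof (cases "M = N")
  case True
  then show ?thesis using assms by simp
next
  case False
  then have less: "M < N" using assms(1) by simp
  show ?thesis unfolding less_eq_multiset\<^sub>H\<^sub>O
  proof (intro allI impI)
    fix y assume y: "count (N + replicate_mset b bot) y < count (M + replicate_mset a bot) y"
    show "\<exists>x>y. count (M + replicate_mset a bot) x < count (N + replicate_mset b bot) x"
    proof (cases "y = bot")
      case True
      obtain x where x: "count M x < count N x" using lt_imp_ex_count_lt[OF less] by blast
      then have "x \<noteq> bot" using assms(2) by (metis not_in_iff not_less0)
      then show ?thesis using x True by (intro exI[of _ x]) (auto simp: bot.not_eq_extremum)
    next
      case False
      then have "count N y < count M y" using y by simp
      then obtain x where "y < x" "count M x < count N x"
        using less unfolding less_multiset\<^sub>H\<^sub>O by blast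
      moreover from this have "x \<noteq> bot" by auto
      ultimately show ?thesis by (intro exI[of _ x]) auto
    qed
  qed
qed

text \<open>The optimal choice of \<open>u\<close> splits the smallest slack \<open>d e\<close> evenly between \<open>es\<close> and \<open>e\<close>: any
  other choice makes the smallest entry smaller. For this \<open>u\<close> the other entries are the slacks
  shifted by \<open>u\<close>, whose order is that of the slacks.\<close>

lemma half_split_optimal:
  fixes d h :: "'a \<Rightarrow> ereal"
  assumes fin: "finite E" and es: "es \<in> E" and S0: "S0 \<subseteq> E - {es}" and S: "S \<subseteq> E - {es}"
    and d: "\<And>e. e \<in> E \<Longrightarrow> \<bar>d e\<bar> \<noteq> \<infinity>"
    and le: "{#- d e. e \<in># mset_set S0#} \<le> {#- d e. e \<in># mset_set S#}"
    and h: "\<And>e. e \<in> S \<Longrightarrow> h es + h e \<le> d e"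
    and u: "u = (INF e\<in>S0. d e / 2)"
  shows "{#- (if e = es then u else if e \<in> S0 then d e - u else \<infinity>). e \<in># mset_set E#}
    \<le> {#- h e. e \<in># mset_set E#}" (is "{#- ?f e. e \<in># _#} \<le> _")
proof (cases "S0 = {}")
  case True
  \<comment> \<open>The minimum over the empty set is \<open>\<infinity>\<close>, so all entries of
    \<open>?f\<close> are \<open>\<infinity>\<close> and their negations are least.\<close>
  then have "u = \<infinity>" using u by (simp add: top_ereal_def)
  then show ?thesis using True by (intro image_mset_mset_set_mono) auto
next
  case False
  have finS: "finite S0" "finite S" using S0 S fin by (auto intro: finite_subset)
  obtain e1 where e1: "e1 \<in> S0" "\<And>e. e \<in> S0 \<Longrightarrow> d e1 \<le> d e"
    using finS(1) False by (metis arg_min_if_finite(1) arg_min_least)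
  have u1: "u = d e1 / 2" unfolding u
    by (rule INF_eqI) (use e1 in \<open>auto intro: ereal_divide_right_mono\<close>)
  obtain r where r: "d e1 = ereal r" using d[of e1] e1(1) S0 by auto
  have ur: "u = ereal (r/2)" by (simp add: u1 r)
  have fu: "u \<le> ?f e" for e
  proof -
    have "u \<le> d e - u" if "e \<in> S0"
      using e1(2)[OF that] r ur d[of e] that S0 by (cases "d e") (auto simp: field_simps)
    then show ?thesis by auto
  qed
  \<comment> \<open>As \<open>u\<close> bounds every \<open>?f e\<close> from below, a single entry
    of \<open>h\<close> under \<open>u\<close> settles the comparison.\<close>
  have strict: ?thesis if "b \<in> E" "h b < u" for b
  proof -
    have "{#- ?f e. e \<in># mset_set E#} < {#- h e. e \<in># mset_set E#}"
    proof (rule image_mset_mset_set_dominated[OF fin that(1)])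
      fix e show "- ?f e < - h b"
        using fu[of e] that(2) by (metis ereal_minus_less_minus less_le_trans)
    qed
    then show ?thesis by simp
  qed
  \<comment> \<open>If all slacks in \<open>S\<close> exceeded \<open>d e1\<close>, then
    \<open>- d e1\<close> would dominate their negations, against \<open>le\<close>.\<close>
  obtain e2 where e2: "e2 \<in> S" "d e2 \<le> d e1"
  proof (rule ccontr)
    assume "\<not> thesis"
    then have "{#- d e. e \<in># mset_set S#} < {#- d e. e \<in># mset_set S0#}"
      using that by (intro image_mset_mset_set_dominated[OF finS(1) e1(1)]) force
    then show False using le by simp
  qed
  have he2: "h es + h e2 \<le> ereal r" using h[OF e2(1)] e2(2) r by simp
  have e2E: "e2 \<in> E" using e2(1) S by auto
  \<comment> \<open>\<open>h es\<close> and \<open>h e2\<close> share at most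
    \<open>r = 2 * u\<close>, so only \<open>h es = u\<close> can keep both from falling below
    \<open>u\<close>.\<close>
  consider "h es < u" | "h es > u" | "h es = u" by force
  then show ?thesis
  proof cases
    case 1
    then show ?thesis using strict es by blast
  next
    case 2
    then have "h e2 < u" using he2 ur
      by (cases "h es"; cases "h e2") auto
    then show ?thesis using strict e2E by blast
  next
    case 3
    \<comment> \<open>\<open>g\<close> is the array of shifted slacks for \<open>S\<close>, with the
      same \<open>u\<close>: \<open>?f\<close> is compared with it through the order of the slacks,
      and it bounds \<open>h\<close> entrywise from above.\<close>
    define g where "g e = (if e = es then u else if e \<in> S then d e - u else \<infinity>)" for e
    have split: "mset_set E = {#es#} + (mset_set C + mset_set (E - {es} - C))" if "C \<subseteq> E - {es}" for C
    proof -
      have "E - {es} = C \<union> (E - {es} - C)" using that by auto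
      then have "mset_set (E - {es}) = mset_set C + mset_set (E - {es} - C)"
        using that fin by (metis mset_set_Union Diff_disjoint finite_Diff finite_subset)
      then show ?thesis using mset_set.remove[OF fin es] by simp
    qed
    have shape: "{#- (if e = es then u else if e \<in> C then d e - u else \<infinity>). e \<in># mset_set E#}
        = {#- u#} + ({#u - d e. e \<in># mset_set C#} + replicate_mset (card (E - {es} - C)) bot)"
      if "C \<subseteq> E - {es}" for C
    proof -
      have "{#- (if e = es then u else if e \<in> C then d e - u else \<infinity>). e \<in># mset_set C#}
          = {#u - d e. e \<in># mset_set C#}"
      proof (rule image_mset_cong)
        fix e assume "e \<in># mset_set C"
        then have "e \<in> C" using that fin finite_subset by (metis elem_mset_set finite_Diff)
        then show "- (if e = es then u else if e \<in> C then d e - u else \<infinity>) = u - d e"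
          using that ur d[of e] by (cases "d e") auto
      qed
      moreover have "{#- (if e = es then u else if e \<in> C then d e - u else \<infinity>). e \<in># mset_set (E - {es} - C)#}
          = {#bot. e \<in># mset_set (E - {es} - C)#}"
        by (rule image_mset_cong) (use fin in \<open>auto simp: bot_ereal_def\<close>)
      ultimately show ?thesis
        by (subst split[OF that]) (simp add: image_mset_const_eq)
    qed
    have "{#- ?f e. e \<in># mset_set E#} \<le> {#- g e. e \<in># mset_set E#}"
      unfolding g_def shape[OF S0] shape[OF S]
    proof (intro add_left_mono le_multiset_pad_bot)
      have "image_mset (\<lambda>x. u + x) {#- d e. e \<in># mset_set S0#} \<le> image_mset (\<lambda>x. u + x) {#- d e. e \<in># mset_set S#}"
      proof (rule image_mset_mono[OF _ le], intro ballI impI)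
        fix x y assume "x \<in># {#- d e. e \<in># mset_set S0#}" "y \<in># {#- d e. e \<in># mset_set S#}" "x < y"
        then obtain e e' where "e \<in> S0" "e' \<in> S" "x = - d e" "y = - d e'"
          using finS by auto
        then show "u + x < u + y"
          using \<open>x < y\<close> d[of e] d[of e'] S0 S ur by (cases "d e"; cases "d e'") auto
      qed
      then show "{#u - d e. e \<in># mset_set S0#} \<le> {#u - d e. e \<in># mset_set S#}"
        by (simp add: image_mset.compositionality comp_def minus_ereal_def)
      have "u - d e \<noteq> bot" if "e \<in> S" for e
        using that d[of e] S ur by (cases "d e") (auto simp: bot_ereal_def)
      then show "bot \<notin># {#u - d e. e \<in># mset_set S#}" using finS by (auto, metis)
      show "size {#u - d e. e \<in># mset_set S0#} + card (E - {es} - S0)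
          = size {#u - d e. e \<in># mset_set S#} + card (E - {es} - S)"
        using S0 S fin finS card_mono[of "E - {es}" S0] card_mono[of "E - {es}" S]
        by (simp add: card_Diff_subset)
    qed
    also have "\<dots> \<le> {#- h e. e \<in># mset_set E#}"
    proof (rule image_mset_mset_set_mono)
      fix e assume "e \<in> E"
      have "h e \<le> d e - u" if "e \<in> S"
        using h[OF that] 3 ur d[OF \<open>e \<in> E\<close>] by (cases "h e"; cases "d e") auto
      then show "- g e \<le> - h e" using 3 by (auto simp: g_def)
    qed
    finally show ?thesis .
  qed
qed

section \<open>The order on arrays of intervals\<close>

text \<open>Negation turns increasingly sorted magnitudes into a decreasing list, so the smaller
  negated multiset belongs to the larger array.\<close>

lemma lex_greater_eqI:
  fixes V1 V2 :: "'v set"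
  assumes "image_mset uminus (bound_magnitudes E \<Lambda>a) \<le> image_mset uminus (bound_magnitudes E \<Lambda>b)"
  shows "lex_greater_eq V1 V2 E \<Lambda>a \<Lambda>b"
proof -
  let ?A = "bound_magnitudes E \<Lambda>a" and ?B = "bound_magnitudes E \<Lambda>b"
  have sz: "size ?A = size ?B" by (simp add: bound_magnitudes_def)
  have len: "length (sorted_list_of_multiset M) = size M" for M :: "ereal multiset"
    by (metis mset_sorted_list_of_multiset size_mset)
  have rev_neg: "rev (sorted_list_of_multiset (image_mset uminus M)) = map uminus (sorted_list_of_multiset M)"
    for M :: "ereal multiset"
  proof -
    have "sorted (rev (map uminus (sorted_list_of_multiset M)))"
      by (simp add: sorted_wrt_rev sorted_wrt_map)
    then have "sort (rev (map uminus (sorted_list_of_multiset M))) = rev (map uminus (sorted_list_of_multiset M))"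
      by (simp add: sorted_sort_id)
    moreover have "mset (rev (map uminus (sorted_list_of_multiset M))) = image_mset uminus M"
      by simp
    ultimately show ?thesis
      by (metis rev_rev_ident sorted_list_of_multiset_mset)
  qed
  show ?thesis
  proof (cases "image_mset uminus ?A = image_mset uminus ?B")
    case True
    then have "image_mset uminus (image_mset uminus ?A) = image_mset uminus (image_mset uminus ?B)"
      by simp
    then have "?A = ?B" by (simp add: image_mset.compositionality comp_def)
    then show ?thesis by (simp add: lex_greater_eq_def rho_def)
  next
    case False
    then have "image_mset uminus ?A < image_mset uminus ?B" using assms by simp
    then obtain i where i: "i < size ?A"
      "- (sorted_list_of_multiset ?A ! i) < - (sorted_list_of_multiset ?B ! i)"
      "\<And>j. j < i \<Longrightarrow> - (sorted_list_of_multiset ?A ! j) = - (sorted_list_of_multiset ?B ! j)"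
      using sz len by (elim less_multiset_imp_first_difference) (auto simp: rev_neg)
    \<comment> \<open>Ranks count from 1 and list positions from 0, so position \<open>i\<close> is
      rank \<open>Suc i\<close>.\<close>
    have eq: "rho E \<Lambda>a k = rho E \<Lambda>b k" if "k \<in> {1..<Suc i}" for k
      using i(3)[of "k - 1"] that sz len[of ?A] len[of ?B] by (auto simp: rho_def Let_def)
    have gt: "rho E \<Lambda>b (Suc i) < rho E \<Lambda>a (Suc i)"
      using i(1,2) sz len[of ?A] len[of ?B] by (auto simp: rho_def Let_def)
    show ?thesis
    \<comment> \<open>There may be more than \<open>card V1 * card V2\<close> bounds; a first
      difference beyond that rank leaves the arrays equal in the order.\<close>
    proof (cases "Suc i \<le> card V1 * card V2")
      case True
      then show ?thesis using eq gt
        unfolding lex_greater_eq_def lex_greater_def by (intro disjI1 bexI[of _ "Suc i"]) auto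
    next
      case False
      then show ?thesis using eq unfolding lex_greater_eq_def by (intro disjI2) auto
    qed
  qed
qed

lemma lex_greater_eq_trans:
  assumes "lex_greater_eq V1 V2 E a b" "lex_greater_eq V1 V2 E b c"
  shows "lex_greater_eq V1 V2 E a c"
proof -
  let ?n = "card V1 * card V2"
  have "lex_greater V1 V2 E a c" if "lex_greater V1 V2 E a b" "lex_greater V1 V2 E b c"
  proof -
    from that obtain i j where i: "i \<in> {1..?n}" "rho E b i < rho E a i" "\<forall>k\<in>{1..<i}. rho E a k = rho E b k"
      and j: "j \<in> {1..?n}" "rho E c j < rho E b j" "\<forall>k\<in>{1..<j}. rho E b k = rho E c k"
      unfolding lex_greater_def by blast
    \<comment> \<open>The first rank at which \<open>a\<close> and \<open>c\<close> differ is the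
      earlier of the two given ones.\<close>
    have "rho E c (min i j) < rho E a (min i j)"
      using i j by (cases i j rule: linorder_cases) auto
    then show ?thesis
      using i j unfolding lex_greater_def by (intro bexI[of _ "min i j"]) auto
  qed
  moreover have "lex_greater V1 V2 E a c"
    if "lex_greater V1 V2 E a b" "\<forall>k\<in>{1..?n}. rho E b k = rho E c k"
    using that unfolding lex_greater_def by (elim bexE, intro bexI) auto
  moreover have "lex_greater V1 V2 E a c"
    if "\<forall>k\<in>{1..?n}. rho E a k = rho E b k" "lex_greater V1 V2 E b c"
    using that unfolding lex_greater_def by (elim bexE, intro bexI) auto
  ultimately show ?thesis
    using assms unfolding lex_greater_eq_def by metis
qed

section \<open>Feasibility and optimality of the interval formula\<close>

lemma L_zero_iff: "\<Lambda> \<in> L_zero E \<longleftrightarrow> (\<forall>e\<in>E. 0 \<le> lam_lo \<Lambda> e \<and> 0 \<le> lam_up \<Lambda> e)"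
  by (simp add: L_zero_def perturbations_def)

text \<open>The bounds are grouped so that \<open>lam_up \<Lambda> es\<close> is compared with the lower bounds it
  constrains in \<open>X_set\<close>, and \<open>lam_lo \<Lambda> es\<close> with the upper bounds it constrains in \<open>A_set\<close>.\<close>

lemma neg_bound_magnitudes_split:
  assumes "\<Lambda> \<in> L_zero E" "finite E" "es \<in> E"
  shows "image_mset uminus (bound_magnitudes E \<Lambda>) =
    {#- (if e = es then lam_up \<Lambda> es else lam_lo \<Lambda> e). e \<in># mset_set E#} +
    {#- (if e = es then lam_lo \<Lambda> es else lam_up \<Lambda> e). e \<in># mset_set E#}"
proof -
  have *: "mset_set E = add_mset es (mset_set (E - {es}))"
    using assms by (simp add: mset_set.remove)
  have nn: "\<bar>lam_lo \<Lambda> e\<bar> = lam_lo \<Lambda> e" "\<bar>lam_up \<Lambda> e\<bar> = lam_up \<Lambda> e" if "e \<in> E" for e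
    using assms(1) that by (auto simp: L_zero_iff)
  have "{#- (if e = es then x else f e). e \<in># mset_set (E - {es})#} = {#- f e. e \<in># mset_set (E - {es})#}"
    for x :: ereal and f
    by (rule image_mset_cong) (use assms in auto)
  moreover have "{#- \<bar>lam_lo \<Lambda> e\<bar>. e \<in># mset_set (E - {es})#} = {#- lam_lo \<Lambda> e. e \<in># mset_set (E - {es})#}"
    "{#- \<bar>lam_up \<Lambda> e\<bar>. e \<in># mset_set (E - {es})#} = {#- lam_up \<Lambda> e. e \<in># mset_set (E - {es})#}"
    by (rule image_mset_cong, use nn assms in auto)+
  ultimately show ?thesis
    using nn[OF assms(3)]
    by (simp add: bound_magnitudes_def * image_mset.compositionality comp_def)
qed

text \<open>Half of the least slack fits into every slack, so the remainder left to each other edge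
  is nonnegative and the constraints hold by construction.\<close>

lemma interval_formula_mem:
  assumes es: "es \<in> \<Pi>" "es \<notin> S" and sub: "S \<subseteq> E" "\<Pi> \<subseteq> E" and disj: "S \<inter> \<Pi> = {}"
    and w: "\<And>e. e \<in> E \<Longrightarrow> \<bar>w e\<bar> \<noteq> \<infinity>"
    and ge: "\<And>e. e \<in> S \<Longrightarrow> w es \<le> w e" and le: "\<And>e. e \<in> \<Pi> \<Longrightarrow> w e \<le> w es"
  shows "interval_formula w es S \<Pi> \<in> L_zero E \<inter> X_set w es S \<inter> A_set w es \<Pi>"
proof -
  define u where "u = (INF e\<in>S. (w e - w es) / 2)"
  define l where "l = (INF e\<in>\<Pi> - {es}. (w es - w e) / 2)"
  have diff: "0 \<le> x - y \<and> 0 \<le> (x - y) / 2" if "y \<le> x" "\<bar>y\<bar> \<noteq> \<infinity>" "\<bar>x\<bar> \<noteq> \<infinity>" for x y :: ereal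
    using that by (cases x; cases y) auto
  have u0: "0 \<le> u" unfolding u_def
    by (rule INF_greatest) (use diff[OF ge w w] sub es in auto)
  have l0: "0 \<le> l" unfolding l_def
    by (rule INF_greatest) (use diff[OF le w w] sub es in auto)
  \<comment> \<open>The first two conjuncts serve \<open>S\<close>, with \<open>y = w es\<close> and
    \<open>v = u\<close>; the last two serve \<open>\<Pi>\<close>, with \<open>x = w es\<close> and
    \<open>v = l\<close>.\<close>
  have aux: "0 \<le> - (y + v - x) \<and> y + v \<le> x - - (y + v - x) \<and> 0 \<le> x - v - y \<and> y + (x - v - y) \<le> x - v"
    if "\<bar>y\<bar> \<noteq> \<infinity>" "\<bar>x\<bar> \<noteq> \<infinity>" "y \<le> x" "0 \<le> v" "v \<le> (x - y) / 2" for v x y :: ereal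
    using that by (cases x; cases y; cases v) auto
  have S: "0 \<le> - (w es + u - w e) \<and> w es + u \<le> w e - - (w es + u - w e)" if "e \<in> S" for e
  proof -
    have "u \<le> (w e - w es) / 2" unfolding u_def by (rule INF_lower[OF that])
    moreover have "es \<in> E" "e \<in> E" using sub es that by auto
    ultimately show ?thesis using aux[OF w w ge[OF that] u0] by blast
  qed
  have P: "0 \<le> w es - l - w e \<and> w e + (w es - l - w e) \<le> w es - l" if "e \<in> \<Pi> - {es}" for e
  proof -
    have "l \<le> (w es - w e) / 2" unfolding l_def by (rule INF_lower[OF that])
    moreover have "es \<in> E" "e \<in> E" "e \<in> \<Pi>" using sub es that by auto
    ultimately show ?thesis using aux[OF w w le l0] by blast
  qed
  let ?F = "interval_formula w es S \<Pi>"
  have F: "?F e = (if e \<in> S then (- (w es + u - w e), \<infinity>) else if e \<in> \<Pi> - {es} then (\<infinity>, w es - l - w e)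
      else if e = es then (l, u) else (\<infinity>, \<infinity>))" for e
    by (simp add: interval_formula_def u_def l_def)
  have F_S: "?F e = (- (w es + u - w e), \<infinity>)" if "e \<in> S" for e using that by (simp add: F)
  have F_P: "?F e = (\<infinity>, w es - l - w e)" if "e \<in> \<Pi> - {es}" for e
    using that disj by (subst F) auto
  have F_es: "?F es = (l, u)" using es by (simp add: F)
  have "0 \<le> lam_lo ?F e \<and> 0 \<le> lam_up ?F e" for e
    using S[of e] P[of e] u0 l0 by (subst (1 2) F) simp
  moreover have "w es + lam_up ?F es \<le> w e - lam_lo ?F e" if "e \<in> S" for e
    using S[OF that] by (simp add: F_S[OF that] F_es)
  moreover have "w e + lam_up ?F e \<le> w es - lam_lo ?F es" if "e \<in> \<Pi> - {es}" for e
    using P[OF that] by (simp add: F_P[OF that] F_es)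
  ultimately show ?thesis
    by (simp add: L_zero_iff X_set_def A_set_def)
qed

text \<open>The two groups of bounds in \<open>neg_bound_magnitudes_split\<close> share no bound, so
  each is optimized by \<open>half_split_optimal\<close> and the multiset inequalities are
  added.\<close>

lemma interval_formula_optimal:
  assumes fin: "finite E" and es: "es \<in> E" and S0: "S0 \<subseteq> E - {es}" and S: "S \<subseteq> E - {es}"
    and P0: "\<Pi>0 \<subseteq> E" and P: "\<Pi> \<subseteq> E" and disj: "S0 \<inter> \<Pi>0 = {}"
    and w: "\<And>e. e \<in> E \<Longrightarrow> \<bar>w e\<bar> \<noteq> \<infinity>"
    and leS: "{#- w e. e \<in># mset_set S0#} \<le> {#- w e. e \<in># mset_set S#}"
    and leP: "{#w e. e \<in># mset_set (\<Pi>0 - {es})#} \<le> {#w e. e \<in># mset_set (\<Pi> - {es})#}"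
    and F: "interval_formula w es S0 \<Pi>0 \<in> L_zero E"
    and L: "\<Lambda> \<in> L_zero E \<inter> X_set w es S \<inter> A_set w es \<Pi>"
  shows "lex_greater_eq V1 V2 E (interval_formula w es S0 \<Pi>0) \<Lambda>"
proof (rule lex_greater_eqI)
  let ?F = "interval_formula w es S0 \<Pi>0"
  define u where "u = (INF e\<in>S0. (w e - w es) / 2)"
  define l where "l = (INF e\<in>\<Pi>0 - {es}. (w es - w e) / 2)"
  have L0: "0 \<le> lam_lo \<Lambda> e" "0 \<le> lam_up \<Lambda> e" if "e \<in> E" for e
    using L that by (auto simp: L_zero_iff)
  have finS: "finite S0" "finite S" "finite \<Pi>0" "finite \<Pi>"
    using fin S0 S P0 P by (auto intro: finite_subset)
  \<comment> \<open>Adding the finite constant \<open>c\<close> is strictly monotone, so a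
    comparison of weights becomes one of slacks relative to \<open>w es\<close>.\<close>
  have shift: "{#- f e. e \<in># mset_set A#} \<le> {#- f e. e \<in># mset_set B#}"
    if le: "{#g e. e \<in># mset_set A#} \<le> {#g e. e \<in># mset_set B#}"
      and AB: "A \<subseteq> E" "B \<subseteq> E" and f: "\<And>e. e \<in> E \<Longrightarrow> - f e = g e + c"
      and g: "\<And>e. e \<in> E \<Longrightarrow> \<bar>g e\<bar> \<noteq> \<infinity>" and c: "\<bar>c\<bar> \<noteq> \<infinity>"
    for f g :: "'a edge \<Rightarrow> ereal" and c A B
  proof -
    have fAB: "finite A" "finite B" using AB fin by (auto intro: finite_subset)
    have "image_mset (\<lambda>x. x + c) {#g e. e \<in># mset_set A#} \<le> image_mset (\<lambda>x. x + c) {#g e. e \<in># mset_set B#}"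
    proof (rule image_mset_mono[OF _ le], intro ballI impI)
      fix x y assume "x \<in># {#g e. e \<in># mset_set A#}" "y \<in># {#g e. e \<in># mset_set B#}" "x < y"
      then show "x + c < y + c"
        using c by (cases x; cases y; cases c) auto
    qed
    moreover have "{#- f e. e \<in># mset_set C#} = image_mset (\<lambda>x. x + c) {#g e. e \<in># mset_set C#}"
      if "C \<subseteq> E" "finite C" for C
      using that f by (auto simp: image_mset.compositionality comp_def intro!: image_mset_cong)
    ultimately show ?thesis using AB fAB by simp
  qed
  have up: "{#- (if e = es then u else if e \<in> S0 then (w e - w es) - u else \<infinity>). e \<in># mset_set E#}
    \<le> {#- (if e = es then lam_up \<Lambda> es else lam_lo \<Lambda> e). e \<in># mset_set E#}"
  proof (rule half_split_optimal[OF fin es S0 S])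
    show "\<bar>w e - w es\<bar> \<noteq> \<infinity>" if "e \<in> E" for e
      using w[OF that] w[OF es] by (cases "w e"; cases "w es") auto
    show "{#- (w e - w es). e \<in># mset_set S0#} \<le> {#- (w e - w es). e \<in># mset_set S#}"
    proof (rule shift[OF leS, where c = "w es"])
      show "- (w e - w es) = - w e + w es" if "e \<in> E" for e
        using w[OF that] w[OF es] by (cases "w e"; cases "w es") auto
    qed (use S0 S w es in auto)
    show "(if es = es then lam_up \<Lambda> es else lam_lo \<Lambda> es) + (if e = es then lam_up \<Lambda> es else lam_lo \<Lambda> e) \<le> w e - w es"
      if "e \<in> S" for e
    proof -
      have "w es + lam_up \<Lambda> es \<le> w e - lam_lo \<Lambda> e" using L that by (auto simp: X_set_def)
      \<comment> \<open>Nonnegative bounds and finite weights make both bounds finite here, so the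
        constraint can be rearranged.\<close>
      then show ?thesis
        using w[of e] w[OF es] L0[of e] L0[OF es] that S
        by (cases "w e"; cases "w es"; cases "lam_up \<Lambda> es"; cases "lam_lo \<Lambda> e") auto
    qed
  qed (use L0 in \<open>auto simp: u_def es\<close>)
  have lo: "{#- (if e = es then l else if e \<in> \<Pi>0 - {es} then (w es - w e) - l else \<infinity>). e \<in># mset_set E#}
    \<le> {#- (if e = es then lam_lo \<Lambda> es else lam_up \<Lambda> e). e \<in># mset_set E#}"
  proof (rule half_split_optimal[OF fin es, where S = "\<Pi> - {es}"])
    show "\<bar>w es - w e\<bar> \<noteq> \<infinity>" if "e \<in> E" for e
      using w[OF that] w[OF es] by (cases "w e"; cases "w es") auto
    show "{#- (w es - w e). e \<in># mset_set (\<Pi>0 - {es})#} \<le> {#- (w es - w e). e \<in># mset_set (\<Pi> - {es})#}"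
    proof (rule shift[OF leP, where c = "- w es"])
      show "- (w es - w e) = w e + - w es" if "e \<in> E" for e
        using w[OF that] w[OF es] by (cases "w e"; cases "w es") auto
    qed (use P0 P w es in auto)
    show "(if es = es then lam_lo \<Lambda> es else lam_up \<Lambda> es) + (if e = es then lam_lo \<Lambda> es else lam_up \<Lambda> e) \<le> w es - w e"
      if "e \<in> \<Pi> - {es}" for e
    proof -
      have "w e + lam_up \<Lambda> e \<le> w es - lam_lo \<Lambda> es" using L that by (auto simp: A_set_def)
      then show ?thesis
        using w[of e] w[OF es] L0[of e] L0[OF es] that P
        by (cases "w e"; cases "w es"; cases "lam_lo \<Lambda> es"; cases "lam_up \<Lambda> e") auto
    qed
  qed (use L0 P0 P in \<open>auto simp: l_def es\<close>)
  have "lam_up ?F es = u" "lam_lo ?F es = l"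
    using S0 by (auto simp: interval_formula_def Let_def u_def l_def)
  moreover have "lam_lo ?F e = (if e \<in> S0 then (w e - w es) - u else \<infinity>)" if "e \<in> E" "e \<noteq> es" for e
    using that w[of e] w[OF es] unfolding interval_formula_def Let_def u_def[symmetric]
    by (cases u; cases "w e"; cases "w es") auto
  \<comment> \<open>The formula tests membership in \<open>S0\<close> first; disjointness ensures
    that edges of \<open>\<Pi>0\<close> reach their own case.\<close>
  moreover have "lam_up ?F e = (if e \<in> \<Pi>0 - {es} then (w es - w e) - l else \<infinity>)" if "e \<in> E" "e \<noteq> es" for e
    using that w[of e] w[OF es] disj unfolding interval_formula_def Let_def l_def[symmetric]
    by (cases l; cases "w e"; cases "w es") auto
  ultimately have
    "{#- (if e = es then lam_up ?F es else lam_lo ?F e). e \<in># mset_set E#}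
      = {#- (if e = es then u else if e \<in> S0 then (w e - w es) - u else \<infinity>). e \<in># mset_set E#}"
    "{#- (if e = es then lam_lo ?F es else lam_up ?F e). e \<in># mset_set E#}
      = {#- (if e = es then l else if e \<in> \<Pi>0 - {es} then (w es - w e) - l else \<infinity>). e \<in># mset_set E#}"
    using fin by (auto intro!: image_mset_cong)
  then show "image_mset uminus (bound_magnitudes E ?F) \<le> image_mset uminus (bound_magnitudes E \<Lambda>)"
    using neg_bound_magnitudes_split[OF F fin es] neg_bound_magnitudes_split[OF _ fin es, of \<Lambda>] L up lo
    by (auto intro: add_mono)
qed

section \<open>Assignments and the Exclusive Set Algorithm\<close>

locale bipartite =
  fixes V1 V2 :: "'v set" and E :: "'v edge set"
  assumes bipartite: "bipartite_graph V1 V2 E"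
begin

lemma finite_E: "finite E"
  using bipartite finite_subset[of E "V1 \<times> V2"] unfolding bipartite_graph_def by simp

lemma assignmentD:
  assumes "\<Pi> \<in> assignments V1 V2 E"
  shows "\<Pi> \<subseteq> E" "finite \<Pi>" "card \<Pi> = card V2" "\<Pi> \<noteq> {}"
proof -
  show sub: "\<Pi> \<subseteq> E" using assms by (simp add: assignments_def)
  then show "finite \<Pi>" using finite_E finite_subset by blast
  have uniq: "\<exists>!e. e \<in> \<Pi> \<and> snd e = v" if "v \<in> V2" for v
    using assms that by (simp add: assignments_def)
  have snd: "snd e \<in> V2" if "e \<in> \<Pi>" for e
    using that sub bipartite unfolding bipartite_graph_def by auto
  have "bij_betw snd \<Pi> V2"
  proof (rule bij_betw_imageI)
    show "inj_on snd \<Pi>" by (rule inj_onI) (metis uniq snd)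
    show "snd ` \<Pi> = V2" using uniq snd by (auto simp: image_iff) (metis snd_conv)
  qed
  then show c: "card \<Pi> = card V2" by (rule bij_betw_same_card)
  show "\<Pi> \<noteq> {}" using c bipartite unfolding bipartite_graph_def by auto
qed

section \<open>Maximum weights and bottleneck edges\<close>

lemma weight_le_max_weight:
  "\<Pi> \<in> assignments V1 V2 E \<Longrightarrow> e \<in> \<Pi> \<Longrightarrow> w e \<le> max_weight w \<Pi>"
  unfolding max_weight_def using assignmentD(2) by (intro Max_ge) auto

lemma max_weight_le_iff:
  "\<Pi> \<in> assignments V1 V2 E \<Longrightarrow> max_weight w \<Pi> \<le> x \<longleftrightarrow> (\<forall>e\<in>\<Pi>. w e \<le> x)"
  unfolding max_weight_def using assignmentD(2,4) by (subst Max_le_iff) auto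

lemma max_weight_mono:
  "\<Pi> \<in> assignments V1 V2 E \<Longrightarrow> (\<And>e. w e \<le> w' e) \<Longrightarrow> max_weight w \<Pi> \<le> max_weight w' \<Pi>"
  by (simp add: max_weight_le_iff) (meson order_trans weight_le_max_weight)

lemma max_weight_attained:
  assumes "\<Pi> \<in> assignments V1 V2 E"
  obtains e where "e \<in> \<Pi>" "w e = max_weight w \<Pi>"
proof -
  have "max_weight w \<Pi> \<in> w ` \<Pi>"
    unfolding max_weight_def by (rule Max_in) (use assignmentD(2,4)[OF assms] in auto)
  then show thesis using that by (metis imageE)
qed

lemma bottleneck_edgeD:
  assumes "e \<in> bottleneck_edges V1 V2 E w"
  obtains \<Pi> where "\<Pi> \<in> assignments V1 V2 E" "e \<in> \<Pi>" "\<And>f. f \<in> \<Pi> \<Longrightarrow> w f \<le> w e"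
    "\<And>\<Pi>'. \<Pi>' \<in> assignments V1 V2 E \<Longrightarrow> w e \<le> max_weight w \<Pi>'"
proof -
  obtain \<Pi> where P: "\<Pi> \<in> assignments V1 V2 E" "e \<in> \<Pi>" "w e = max_weight w \<Pi>"
    "\<forall>\<Pi>'\<in>assignments V1 V2 E. max_weight w \<Pi> \<le> max_weight w \<Pi>'"
    using assms unfolding bottleneck_edges_def bottleneck_assignments_def by blast
  show thesis using that[OF P(1,2)] P(3,4) weight_le_max_weight[OF P(1)] by simp
qed

lemma bottleneck_edgeI:
  assumes "\<Pi> \<in> assignments V1 V2 E" "e \<in> \<Pi>" "\<And>f. f \<in> \<Pi> \<Longrightarrow> w f \<le> w e"
    "\<And>\<Pi>'. \<Pi>' \<in> assignments V1 V2 E \<Longrightarrow> w e \<le> max_weight w \<Pi>'"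
  shows "e \<in> bottleneck_edges V1 V2 E w"
proof -
  have "max_weight w \<Pi> = w e"
    using assms weight_le_max_weight max_weight_le_iff by (meson antisym)
  then show ?thesis
    using assms unfolding bottleneck_edges_def bottleneck_assignments_def by auto
qed

lemma bottleneck_edge_in_E: "e \<in> bottleneck_edges V1 V2 E w \<Longrightarrow> e \<in> E"
  using assignmentD(1) by (elim bottleneck_edgeD) auto

section \<open>Exclusive sets and runs of the algorithm\<close>

lemma exclusive_setD:
  assumes "S \<in> exclusive_sets V1 V2 E es"
  shows "S \<subseteq> E - {es}" "\<And>\<Pi>. \<Pi> \<in> assignments V1 V2 E \<Longrightarrow> es \<notin> \<Pi> \<Longrightarrow> \<exists>e\<in>S. e \<in> \<Pi>"
proof -
  show "S \<subseteq> E - {es}" using assms unfolding exclusive_sets_def by auto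
  fix \<Pi> assume "\<Pi> \<in> assignments V1 V2 E" "es \<notin> \<Pi>"
  then show "\<exists>e\<in>S. e \<in> \<Pi>"
    using assms unfolding exclusive_sets_def assignments_with_def by blast
qed

lemma exclusive_setI:
  assumes "es \<in> E" "S \<subseteq> E - {es}" "\<And>\<Pi>. \<Pi> \<in> assignments V1 V2 E \<Longrightarrow> es \<notin> \<Pi> \<Longrightarrow> \<exists>e\<in>S. e \<in> \<Pi>"
  shows "S \<in> exclusive_sets V1 V2 E es"
  using assms unfolding exclusive_sets_def assignments_with_def by blast

text \<open>Loop invariant: the collected set determines the current weights. As \<open>es\<close>
  starts with weight \<open>\<infinity>\<close>, it is never collected.\<close>

lemma esa_reach_weights:
  assumes "esa_reach V1 V2 E w es S w'"
  shows "S \<subseteq> E - {es} \<and> w' = (\<lambda>e. if e \<in> insert es S then \<infinity> else w e)"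
  using assms
proof induction
  case (step S w' e)
  then show ?case using bottleneck_edge_in_E[OF step.hyps(2)] by (auto split: if_splits)
qed auto

text \<open>On exit the bottleneck value is \<open>\<infinity>\<close>, so every assignment contains
  an edge whose weight was raised, that is, \<open>es\<close> or a collected edge.\<close>

lemma esa_returns_exclusive:
  assumes es: "es \<in> E" and w: "\<And>e. e \<in> E \<Longrightarrow> w e \<noteq> \<infinity>" and ret: "esa_returns V1 V2 E w es S"
  shows "S \<in> exclusive_sets V1 V2 E es"
proof -
  obtain w' e where reach: "esa_reach V1 V2 E w es S w'"
    and e: "e \<in> bottleneck_edges V1 V2 E w'" "w' e = \<infinity>"
    using ret unfolding esa_returns_def by blast
  show ?thesis
  proof (rule exclusive_setI[OF es])
    show "S \<subseteq> E - {es}" using esa_reach_weights[OF reach] by simp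
    fix \<Pi> assume P: "\<Pi> \<in> assignments V1 V2 E" "es \<notin> \<Pi>"
    obtain f where "f \<in> \<Pi>" "w' f = max_weight w' \<Pi>" using max_weight_attained[OF P(1)] .
    moreover have "max_weight w' \<Pi> = \<infinity>" using e P(1) by (elim bottleneck_edgeD) force
    ultimately show "\<exists>e\<in>S. e \<in> \<Pi>"
      using esa_reach_weights[OF reach] w[of f] assignmentD(1)[OF P(1)] P(2) by (auto split: if_splits)
  qed
qed

text \<open>Each removed edge had the bottleneck value as its weight when removed, and later steps
  only raise weights, so bottleneck values never decrease.\<close>

lemma esa_reach_weight_le:
  assumes "esa_reach V1 V2 E w es S w'" and "es \<in> bottleneck_edges V1 V2 E w"
    and "f \<in> insert es S" and "\<Pi> \<in> assignments V1 V2 E"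
  shows "w f \<le> max_weight w' \<Pi>"
  using assms(1,3,4)
proof (induction arbitrary: f \<Pi>)
  case init
  then have "w es \<le> max_weight w \<Pi>" using assms(2) by (elim bottleneck_edgeD) auto
  also have "\<dots> \<le> max_weight (w(es := \<infinity>)) \<Pi>" by (rule max_weight_mono) (use init in auto)
  finally show ?case using init by (simp only: insert_iff empty_iff simp_thms)
next
  case (step S w' e)
  have w': "w' = (\<lambda>e. if e \<in> insert es S then \<infinity> else w e)"
    using esa_reach_weights[OF step.hyps(1)] by simp
  have "w f \<le> max_weight w' \<Pi>"
  proof (cases "f \<in> insert es S")
    case True
    then show ?thesis using step by blast
  next
    case False
    then have "f = e" "w f = w' f" using step.prems w' by auto
    then show ?thesis using step.hyps(2) step.prems(2) by (auto elim: bottleneck_edgeD)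
  qed
  also have "\<dots> \<le> max_weight (w'(e := \<infinity>)) \<Pi>" by (rule max_weight_mono) (use step in auto)
  finally show ?case .
qed

text \<open>A collected edge is heaviest in an assignment whose maximum is at least
  \<open>w es\<close> by \<open>esa_reach_weight_le\<close>.\<close>

lemma esa_reach_weight_ge:
  assumes "esa_reach V1 V2 E w es S w'" and "es \<in> bottleneck_edges V1 V2 E w" and "f \<in> S"
  shows "w es \<le> w f"
  using assms(1,3)
proof (induction arbitrary: f)
  case (step S w' e)
  show ?case
  proof (cases "f = e")
    case True
    obtain \<Pi> where P: "\<Pi> \<in> assignments V1 V2 E" "\<And>f. f \<in> \<Pi> \<Longrightarrow> w' f \<le> w' e"
      using bottleneck_edgeD[OF step.hyps(2)] by metis
    have "w es \<le> max_weight w' \<Pi>"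
      using esa_reach_weight_le[OF step.hyps(1) assms(2) _ P(1)] by simp
    also have "\<dots> \<le> w' e" using P by (simp add: max_weight_le_iff)
    also have "\<dots> = w e" using step.hyps(3) esa_reach_weights[OF step.hyps(1)] by (auto split: if_splits)
    finally show ?thesis using True by simp
  qed (use step in auto)
qed simp

text \<open>Greedy argument: each bottleneck assignment met by the algorithm avoids all edges collected
  so far, so it contains a further edge of \<open>S0\<close>, which is the bottleneck edge itself or lighter.\<close>

lemma esa_reach_exchange:
  assumes reach: "esa_reach V1 V2 E w es S w'" and es: "es \<in> bottleneck_edges V1 V2 E w"
    and uniq: "uniqueness_assumption V1 V2 E w es"
    and S0: "S0 \<in> exclusive_sets V1 V2 E es"
  shows "S \<subseteq> S0 \<or> (\<exists>T\<subseteq>S \<inter> S0. S - T \<noteq> {} \<and> (\<exists>b\<in>S0 - T. \<forall>f\<in>S - T. w b < w f))"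
  using reach
proof induction
  case init
  show ?case by simp
next
  case (step S w' e)
  have w': "w' = (\<lambda>e. if e \<in> insert es S then \<infinity> else w e)"
    using esa_reach_weights[OF step.hyps(1)] by simp
  have e: "e \<notin> insert es S" "w' e = w e" using step.hyps(3) w' by (auto split: if_splits)
  obtain \<Pi> where P: "\<Pi> \<in> assignments V1 V2 E" "e \<in> \<Pi>" "\<And>f. f \<in> \<Pi> \<Longrightarrow> w' f \<le> w' e"
    "\<And>\<Pi>'. \<Pi>' \<in> assignments V1 V2 E \<Longrightarrow> w' e \<le> max_weight w' \<Pi>'"
    using bottleneck_edgeD[OF step.hyps(2)] by metis
  have max: "max_weight w' \<Pi> = w e"
    using P max_weight_le_iff weight_le_max_weight e(2) by (metis antisym)
  from step.IH show ?case
  proof (elim disjE exE bexE conjE)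
    \<comment> \<open>Once the run has left \<open>S0\<close>, later edges are at least as heavy as
      the collected ones, so the same \<open>T\<close> and \<open>b\<close> remain
      witnesses.\<close>
    fix T b assume T: "T \<subseteq> S \<inter> S0" "S - T \<noteq> {}" "b \<in> S0 - T" "\<forall>f\<in>S - T. w b < w f"
    then obtain f where f: "f \<in> S - T" by auto
    then have "w f \<le> w e"
      using esa_reach_weight_le[OF step.hyps(1) es _ P(1), of f] max by auto
    then have "w b < w e" using T f by (meson less_le_trans)
    then show ?thesis using T by (intro disjI2 exI[of _ T]) auto
  next
    assume sub: "S \<subseteq> S0"
    have avoid: "f \<notin> insert es S" if "f \<in> \<Pi>" for f
      using P(3)[OF that] step.hyps(3) w' by auto
    then obtain g where g: "g \<in> S0" "g \<in> \<Pi>" "g \<notin> S"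
      using exclusive_setD(2)[OF S0 P(1)] by blast
    have wg: "w' g = w g" "w g \<le> w e" using avoid[OF g(2)] w' P(3)[OF g(2)] e(2) by auto
    show ?thesis
    proof (cases "w g = w e")
      case True
      \<comment> \<open>A tie makes \<open>g\<close> a second bottleneck edge, which uniqueness
        identifies with \<open>e\<close>.\<close>
      have "g \<in> bottleneck_edges V1 V2 E w'"
        by (rule bottleneck_edgeI[OF P(1) g(2)]) (use P wg e True in auto)
      then have "g = e"
        using uniq step.hyps unfolding uniqueness_assumption_def by blast
      then show ?thesis using sub g by auto
    next
      case False
      \<comment> \<open>The run leaves \<open>S0\<close> for the first time here: everything
        collected so far becomes \<open>T\<close>, and the lighter edge \<open>g\<close> becomes
        \<open>b\<close>.\<close>
      then show ?thesis using sub g wg e by (intro disjI2 exI[of _ S] conjI bexI[of _ g]) auto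
    qed
  qed
qed

section \<open>The lexicographic assignment\<close>

text \<open>All assignments have \<open>card V2\<close> edges, so a smaller multiset would yield a
  first difference in the decreasing weights, which the definition forbids.\<close>

lemma lexicographic_assignment_le:
  assumes "lexicographic_assignment V1 V2 E w \<Pi>" and P': "\<Pi>' \<in> assignments V1 V2 E"
  shows "image_mset w (mset_set \<Pi>) \<le> image_mset w (mset_set \<Pi>')"
proof (rule ccontr)
  assume "\<not> ?thesis"
  then have less: "image_mset w (mset_set \<Pi>') < image_mset w (mset_set \<Pi>)" by simp
  have P: "\<Pi> \<in> assignments V1 V2 E" using assms(1) by (simp add: lexicographic_assignment_def)
  obtain i where "i < card V2" "weight_rank w \<Pi>' (Suc i) < weight_rank w \<Pi> (Suc i)"
    "\<forall>j<i. weight_rank w \<Pi>' (Suc j) = weight_rank w \<Pi> (Suc j)"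
    using less_multiset_imp_first_difference[OF less] assignmentD[OF P] assignmentD[OF P']
    unfolding weight_rank_def by auto
  moreover from this have "\<forall>j\<in>{1..<Suc i}. weight_rank w \<Pi>' j = weight_rank w \<Pi> j"
    by (metis Suc_le_eq atLeastLessThan_iff less_Suc_eq_le not0_implies_Suc not_one_le_zero)
  ultimately show False
    using assms unfolding lexicographic_assignment_def
    by (metis Suc_le_eq Suc_le_mono One_nat_def atLeastAtMost_iff le0)
qed

text \<open>Minimizing the sorted weights first minimizes the largest one, so each heaviest edge of
  \<open>\<Pi>\<close> is a bottleneck edge and by uniqueness equals \<open>es\<close>.\<close>

lemma lexicographic_assignment_bottleneck:
  assumes lexi: "lexicographic_assignment V1 V2 E w \<Pi>"
    and uniq: "\<exists>!e. e \<in> bottleneck_edges V1 V2 E w" and es: "es \<in> bottleneck_edges V1 V2 E w"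
  shows "es \<in> \<Pi>" "\<And>e. e \<in> \<Pi> \<Longrightarrow> w e \<le> w es" "\<And>e. e \<in> \<Pi> \<Longrightarrow> w es \<le> w e \<Longrightarrow> e = es"
proof -
  have P: "\<Pi> \<in> assignments V1 V2 E" using lexi by (simp add: lexicographic_assignment_def)
  obtain e where e: "e \<in> \<Pi>" "w e = max_weight w \<Pi>" using max_weight_attained[OF P] .
  have min: "max_weight w \<Pi> \<le> max_weight w \<Pi>'" if P': "\<Pi>' \<in> assignments V1 V2 E" for \<Pi>'
  proof (rule ccontr)
    assume "\<not> ?thesis"
    then have "w f < w e" if "f \<in> \<Pi>'" for f
      using weight_le_max_weight[OF P' that, of w] e(2) by simp
    then have "image_mset w (mset_set \<Pi>') < image_mset w (mset_set \<Pi>)"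
      using image_mset_mset_set_dominated[OF assignmentD(2)[OF P] e(1)] by blast
    then show False using lexicographic_assignment_le[OF lexi P'] by simp
  qed
  have max_edge: "f = es" if "f \<in> \<Pi>" "w f = max_weight w \<Pi>" for f
  proof -
    have "f \<in> bottleneck_edges V1 V2 E w"
      by (rule bottleneck_edgeI[OF P that(1)]) (use that min weight_le_max_weight[OF P] in auto)
    then show ?thesis using uniq es by blast
  qed
  show "es \<in> \<Pi>" using max_edge e by blast
  have "e = es" using max_edge e by blast
  then show le: "w f \<le> w es" if "f \<in> \<Pi>" for f
    using weight_le_max_weight[OF P that, of w] e by simp
  show "f = es" if "f \<in> \<Pi>" "w es \<le> w f" for f
    using max_edge[OF that(1)] antisym[OF le[OF that(1)] that(2)] e(2) \<open>e = es\<close> by metis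
qed

section \<open>Arrays under which an edge stays a bottleneck edge\<close>

text \<open>Under any admissible perturbation, \<open>A_set\<close> keeps \<open>es\<close> heaviest
  in \<open>\<Pi>\<close>, while \<open>X_set\<close> gives every assignment avoiding
  \<open>es\<close> an edge of \<open>S\<close> at least as heavy.\<close>

lemma L_E_I:
  assumes P: "\<Pi> \<in> assignments_with V1 V2 E es" and S: "S \<in> exclusive_sets V1 V2 E es"
    and L: "\<Lambda> \<in> X_set w es S \<inter> A_set w es \<Pi>"
  shows "\<Lambda> \<in> L_E V1 V2 E w es"
  unfolding L_E_def
proof (intro CollectI ballI)
  fix P assume "P \<in> perturbations E \<Lambda>"
  then have Pe: "- lam_lo \<Lambda> e \<le> P e" "P e \<le> lam_up \<Lambda> e" if "e \<in> E" for e
    using that by (auto simp: perturbations_def)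
  have Pi: "\<Pi> \<in> assignments V1 V2 E" "es \<in> \<Pi>" using P by (auto simp: assignments_with_def)
  note sub = assignmentD(1)[OF Pi(1)] exclusive_setD(1)[OF S]
  show "es \<in> bottleneck_edges V1 V2 E (\<lambda>e. w e + P e)"
  proof (rule bottleneck_edgeI[OF Pi])
    fix f assume f: "f \<in> \<Pi>"
    show "w f + P f \<le> w es + P es"
    proof (cases "f = es")
      case False
      have "w f + P f \<le> w f + lam_up \<Lambda> f" by (rule add_left_mono) (use Pe sub f in blast)
      also have "\<dots> \<le> w es - lam_lo \<Lambda> es" using L f False by (auto simp: A_set_def)
      also have "\<dots> \<le> w es + P es"
        unfolding minus_ereal_def by (rule add_left_mono) (use Pe sub Pi in blast)
      finally show ?thesis .
    qed simp
  next
    fix \<Pi>' assume P': "\<Pi>' \<in> assignments V1 V2 E"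
    show "w es + P es \<le> max_weight (\<lambda>e. w e + P e) \<Pi>'"
    proof (cases "es \<in> \<Pi>'")
      case True
      then show ?thesis using weight_le_max_weight[OF P'] by fast
    next
      case False
      then obtain g where g: "g \<in> S" "g \<in> \<Pi>'" using exclusive_setD(2)[OF S P'] by blast
      have "w es + P es \<le> w es + lam_up \<Lambda> es" by (rule add_left_mono) (use Pe sub Pi in blast)
      also have "\<dots> \<le> w g - lam_lo \<Lambda> g" using L g by (auto simp: X_set_def)
      also have "\<dots> \<le> w g + P g"
        unfolding minus_ereal_def by (rule add_left_mono) (use Pe sub g in blast)
      also have "\<dots> \<le> max_weight (\<lambda>e. w e + P e) \<Pi>'"
        using weight_le_max_weight[OF P' g(2), of "\<lambda>e. w e + P e"] .
      finally show ?thesis .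
    qed
  qed
qed

text \<open>The set and the assignment come from the two extreme perturbations: \<open>es\<close> as heavy and all
  other edges as light as possible, and vice versa.\<close>

lemma L_E_D:
  assumes L: "\<Lambda> \<in> L_zero E \<inter> L_E V1 V2 E w es"
  obtains \<Pi> S where "\<Pi> \<in> assignments_with V1 V2 E es" "S \<in> exclusive_sets V1 V2 E es"
    "\<Lambda> \<in> X_set w es S \<inter> A_set w es \<Pi>"
proof -
  have L0: "- lam_lo \<Lambda> e \<le> lam_up \<Lambda> e" if "e \<in> E" for e
    using L that by (force simp: L_zero_iff intro: order_trans[of _ 0])
  have bott: "es \<in> bottleneck_edges V1 V2 E (\<lambda>e. w e + P e)"
    if "\<And>e. e \<in> E \<Longrightarrow> P e \<in> {- lam_lo \<Lambda> e..lam_up \<Lambda> e}" for P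
    using L that unfolding L_E_def perturbations_def by blast
  define P1 where "P1 e = (if e = es then lam_up \<Lambda> e else - lam_lo \<Lambda> e)" for e
  define P2 where "P2 e = (if e = es then - lam_lo \<Lambda> e else lam_up \<Lambda> e)" for e
  have b1: "es \<in> bottleneck_edges V1 V2 E (\<lambda>e. w e + P1 e)"
    by (rule bott) (use L0 in \<open>auto simp: P1_def\<close>)
  have b2: "es \<in> bottleneck_edges V1 V2 E (\<lambda>e. w e + P2 e)"
    by (rule bott) (use L0 in \<open>auto simp: P2_def\<close>)
  \<comment> \<open>The largest set of other edges satisfying the \<open>X_set\<close> constraint;
    \<open>P1\<close> shows that it is exclusive.\<close>
  define S where "S = {e \<in> E - {es}. w es + lam_up \<Lambda> es \<le> w e - lam_lo \<Lambda> e}"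
  have "S \<in> exclusive_sets V1 V2 E es"
  proof (rule exclusive_setI[OF bottleneck_edge_in_E[OF b1]])
    fix \<Pi> assume P: "\<Pi> \<in> assignments V1 V2 E" "es \<notin> \<Pi>"
    obtain e where e: "e \<in> \<Pi>" "w e + P1 e = max_weight (\<lambda>e. w e + P1 e) \<Pi>"
      using max_weight_attained[OF P(1), of "\<lambda>e. w e + P1 e"] by blast
    then have "w es + P1 es \<le> w e + P1 e" using b1 P(1) by (auto elim: bottleneck_edgeD)
    moreover have "e \<noteq> es" using e P by auto
    ultimately have "e \<in> S"
      using e(1) assignmentD(1)[OF P(1)] by (auto simp: S_def P1_def minus_ereal_def)
    then show "\<exists>e\<in>S. e \<in> \<Pi>" using e(1) by blast
  qed (auto simp: S_def)
  moreover obtain \<Pi> where P: "\<Pi> \<in> assignments V1 V2 E" "es \<in> \<Pi>"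
    "\<And>f. f \<in> \<Pi> \<Longrightarrow> w f + P2 f \<le> w es + P2 es"
    using bottleneck_edgeD[OF b2] by metis
  have "w e + lam_up \<Lambda> e \<le> w es - lam_lo \<Lambda> es" if "e \<in> \<Pi> - {es}" for e
    using P(3)[of e] that by (auto simp: P2_def minus_ereal_def)
  then have "\<Lambda> \<in> X_set w es S \<inter> A_set w es \<Pi>"
    by (auto simp: X_set_def A_set_def S_def)
  ultimately show thesis using that P by (auto simp: assignments_with_def)
qed

end

theorem theorem2:
  fixes V1 V2 :: "'v set" and E :: "'v edge set" and w :: "'v edge \<Rightarrow> ereal"
    and es :: "'v edge" and Shat Pihat :: "'v edge set"
  assumes "bipartite_graph V1 V2 E"
    and "weight_matrix V1 V2 E w"
    and "es \<in> bottleneck_edges V1 V2 E w"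
    and "esa_returns V1 V2 E w es Shat"
    and "lexicographic_assignment V1 V2 E w Pihat"
  shows "Shat \<in> exclusive_sets V1 V2 E es \<and>
    (uniqueness_assumption V1 V2 E w es \<and> (\<forall>e\<in>E. w e \<noteq> -\<infinity>) \<longrightarrow>
      (\<forall>Pi\<in>assignments_with V1 V2 E es. \<forall>S\<in>exclusive_sets V1 V2 E es. \<forall>\<Lambda>a \<Lambda>b.
         is_lexmax V1 V2 E (L_zero E \<inter> X_set w es Shat \<inter> A_set w es Pihat) \<Lambda>a \<and>
         is_lexmax V1 V2 E (L_zero E \<inter> X_set w es S \<inter> A_set w es Pi) \<Lambda>b \<longrightarrow>
         lex_greater_eq V1 V2 E \<Lambda>a \<Lambda>b) \<and>
      is_lexmax V1 V2 E (L_zero E \<inter> X_set w es Shat \<inter> A_set w es Pihat)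
        (interval_formula w es Shat Pihat) \<and>
      is_lexmax V1 V2 E (L_zero E \<inter> L_E V1 V2 E w es) (interval_formula w es Shat Pihat) \<and>
      (\<forall>\<Lambda>. is_lexmax V1 V2 E (L_zero E \<inter> X_set w es Shat \<inter> A_set w es Pihat) \<Lambda> \<longrightarrow>
           is_lexmax V1 V2 E (L_zero E \<inter> L_E V1 V2 E w es) \<Lambda>))"
proof -
  interpret bipartite V1 V2 E by unfold_locales (rule assms(1))
  have es: "es \<in> E" using assms(3) by (rule bottleneck_edge_in_E)
  have w_top: "w e \<noteq> \<infinity>" if "e \<in> E" for e using assms(2) that by (simp add: weight_matrix_def)
  have Shat: "Shat \<in> exclusive_sets V1 V2 E es"
    by (rule esa_returns_exclusive[OF es w_top assms(4)])
  have Pihat: "Pihat \<in> assignments V1 V2 E"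
    using assms(5) by (simp add: lexicographic_assignment_def)
  let ?F = "interval_formula w es Shat Pihat"
  \<comment> \<open>The core is that \<open>?F\<close> is feasible and dominates every array of
    every \<open>?I S Pi\<close>; the remaining claims follow by transitivity.\<close>
  let ?I = "\<lambda>S \<Pi>. L_zero E \<inter> X_set w es S \<inter> A_set w es \<Pi>"
  have concl: "is_lexmax V1 V2 E (?I Shat Pihat) ?F \<and>
      (\<forall>Pi\<in>assignments_with V1 V2 E es. \<forall>S\<in>exclusive_sets V1 V2 E es. \<forall>\<Lambda>\<in>?I S Pi.
        lex_greater_eq V1 V2 E ?F \<Lambda>) \<and> Pihat \<in> assignments_with V1 V2 E es"
    if uniq: "uniqueness_assumption V1 V2 E w es" and fin: "\<forall>e\<in>E. w e \<noteq> -\<infinity>"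
  proof -
    have w: "\<bar>w e\<bar> \<noteq> \<infinity>" if "e \<in> E" for e using w_top[OF that] fin that by (cases "w e") auto
    have ex1: "\<exists>!e. e \<in> bottleneck_edges V1 V2 E w"
      using uniq by (simp add: uniqueness_assumption_def)
    note Pihat_max = lexicographic_assignment_bottleneck[OF assms(5) ex1 assms(3)]
    obtain w' e' where reach: "esa_reach V1 V2 E w es Shat w'"
      using assms(4) unfolding esa_returns_def by blast
    have ge: "w es \<le> w e" if e: "e \<in> Shat" for e
      using esa_reach_weight_ge[OF reach assms(3) e] .
    \<comment> \<open>Collected edges weigh at least \<open>w es\<close>, a weight that only
      \<open>es\<close> itself reaches in \<open>Pihat\<close>.\<close>
    have disj: "Shat \<inter> Pihat = {}"
      using ge Pihat_max(3) exclusive_setD(1)[OF Shat] by blast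
    have F: "?F \<in> ?I Shat Pihat"
      by (rule interval_formula_mem)
        (use Pihat_max exclusive_setD(1)[OF Shat] assignmentD(1)[OF Pihat] disj w ge in auto)
    have opt: "lex_greater_eq V1 V2 E ?F \<Lambda>"
      if P: "Pi \<in> assignments_with V1 V2 E es" and S: "S \<in> exclusive_sets V1 V2 E es"
        and L: "\<Lambda> \<in> ?I S Pi" for Pi S \<Lambda>
    proof (rule interval_formula_optimal[OF finite_E es _ _ _ _ disj w _ _ _ L])
      have Pi: "Pi \<in> assignments V1 V2 E" "es \<in> Pi" using P by (auto simp: assignments_with_def)
      show sub: "Shat \<subseteq> E - {es}" "S \<subseteq> E - {es}" "Pihat \<subseteq> E" "Pi \<subseteq> E"
        using exclusive_setD(1) Shat S assignmentD(1) Pihat Pi by auto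
      have finS: "finite Shat" "finite S"
        using sub finite_E by (meson finite_Diff finite_subset)+
      show "{#- w e. e \<in># mset_set Shat#} \<le> {#- w e. e \<in># mset_set S#}"
        using esa_reach_exchange[OF reach assms(3) uniq S]
      proof (elim disjE exE bexE conjE)
        assume "Shat \<subseteq> S"
        then show ?thesis
          using finS by (intro subset_eq_imp_le_multiset image_mset_subseteq_mono) (simp add: subset_imp_msubset_mset_set)
      next
        fix T b assume T: "T \<subseteq> Shat \<inter> S" "b \<in> S - T" "\<forall>f\<in>Shat - T. w b < w f"
        show ?thesis
          by (rule image_mset_mset_set_exchange[OF finS _ _ T(2)]) (use T in auto)
      qed
      \<comment> \<open>Both assignments contain \<open>es\<close>, so its weight cancels from the
        comparison.\<close>
      have "mset_set Q = add_mset es (mset_set (Q - {es}))" if "Q \<in> assignments V1 V2 E" "es \<in> Q" for Q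
        using that assignmentD(2) by (simp add: mset_set.remove)
      then show "{#w e. e \<in># mset_set (Pihat - {es})#} \<le> {#w e. e \<in># mset_set (Pi - {es})#}"
        using lexicographic_assignment_le[OF assms(5) Pi(1)] Pi Pihat Pihat_max(1) by simp
      show "?F \<in> L_zero E" using F by blast
    qed
    have PE: "Pihat \<in> assignments_with V1 V2 E es"
      using Pihat Pihat_max(1) by (simp add: assignments_with_def)
    show ?thesis using F opt PE Shat unfolding is_lexmax_def by blast
  qed
  have LE: "is_lexmax V1 V2 E (L_zero E \<inter> L_E V1 V2 E w es) \<Lambda>"
    if "is_lexmax V1 V2 E (?I Shat Pihat) \<Lambda>"
      and "uniqueness_assumption V1 V2 E w es" "\<forall>e\<in>E. w e \<noteq> -\<infinity>" for \<Lambda>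
  proof -
    note c = concl[OF that(2,3)]
    have L: "\<Lambda> \<in> ?I Shat Pihat" "lex_greater_eq V1 V2 E \<Lambda> ?F"
      using that(1) c unfolding is_lexmax_def by blast+
    have "lex_greater_eq V1 V2 E \<Lambda> \<Lambda>'" if L': "\<Lambda>' \<in> L_zero E \<inter> L_E V1 V2 E w es" for \<Lambda>'
    proof -
      \<comment> \<open>Every array preserving \<open>es\<close> as a bottleneck edge lies in some
        \<open>?I S Pi\<close>, where \<open>?F\<close> already dominates.\<close>
      obtain Pi S where "Pi \<in> assignments_with V1 V2 E es" "S \<in> exclusive_sets V1 V2 E es"
        "\<Lambda>' \<in> X_set w es S \<inter> A_set w es Pi"
        using L_E_D[OF L'] .
      then have "lex_greater_eq V1 V2 E ?F \<Lambda>'" using c L' by blast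
      then show ?thesis using L(2) lex_greater_eq_trans by blast
    qed
    then show ?thesis
      using L(1) L_E_I[OF _ Shat] c unfolding is_lexmax_def by blast
  qed
  show ?thesis
  proof (intro conjI impI ballI allI Shat; elim conjE)
    fix Pi S \<Lambda>a \<Lambda>b
    assume a: "uniqueness_assumption V1 V2 E w es" "\<forall>e\<in>E. w e \<noteq> -\<infinity>"
      "Pi \<in> assignments_with V1 V2 E es" "S \<in> exclusive_sets V1 V2 E es"
      "is_lexmax V1 V2 E (?I Shat Pihat) \<Lambda>a" "is_lexmax V1 V2 E (?I S Pi) \<Lambda>b"
    then have "lex_greater_eq V1 V2 E \<Lambda>a ?F" "lex_greater_eq V1 V2 E ?F \<Lambda>b"
      using concl[OF a(1,2)] unfolding is_lexmax_def by blast+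
    then show "lex_greater_eq V1 V2 E \<Lambda>a \<Lambda>b" by (rule lex_greater_eq_trans)
  qed (use concl LE in blast)+
qed

end
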